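(* There exists an absolute constant $C>0$ (any $C>\frac{50}{3}$ works) such that for any $0<\mu<L$, with $\kappa=\mu/L$, $$\big(\Omega_{\circ}(\mathcal F_{\mu,L})\big)^c\ \cap\ \mathrm{SLS}_{\mu,L}\!\left(\frac{1-C\kappa}{1+C\kappa}\right)=\emptyset .$$
   Context: For $0<\mu\le L$, $\mathcal F_{\mu,L}$ is the set of continuously differentiable functions $f:\mathbb R^d\to\mathbb R$ ($d\ge1$ arbitrary) with $f(x)\le f(y)+\langle\nabla f(y),x-y\rangle+\frac L2\|x-y\|^2$ and $f(x)\ge f(y)+\langle\nabla f(y),x-y\rangle+\frac\mu2\|x-y\|^2$ for all $x,y$. $\mathcal Q_{\mu,L}\subseteq\mathcal F_{\mu,L}$ is the subset of quadratic functions $f(x)=\frac12\langle x,Hx\rangle+\langle b,x\rangle+c$ with $H$ symmetric and spectrum of $H$ contained in $[\mu,L]$. For $\gamma,\beta\in\mathbb R$ and differentiable $f$, $\mathrm{HB}_{\gamma,\beta}(f)$ is the iteration $x_{t+1}=x_t-\gamma\nabla f(x_t)+\beta(x_t-x_{t-1})$, $t\ge1$, from initial points $x_0,x_1$. Rate: $\mathrm{HB}_{\gamma,\beta}$ has worst-case asymptotic rate $\rho\ge0$ over a class $\mathcal F$ if for all $\varepsilon>0$ there is $T_0$ such that for all $f\in\mathcal F$ (with minimizer $x_\star$), all initial points $x_0,x_1$ and all $T\ge T_0$, $\|x_T-x_\star\|\le(\rho+\varepsilon)^T\big(\|x_0-x_\star\|^2+\|x_1-x_\star\|^2\big)^{1/2}$.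 $\rho_{\gamma,\beta}(\mathcal F)$ is the smallest such $\rho$ ($+\infty$ if none). (It is classical that $\rho_{\gamma,\beta}(\mathcal Q_{\mu,L})$ is the maximum over $\lambda\in[\mu,L]$ of the spectral radius of $\begin{pmatrix}1+\beta-\gamma\lambda&-\beta\\1&0\end{pmatrix}$ whenever this maximum is $<1$.) Sublevel set: $\mathrm{SLS}_{\mu,L}(\rho)=\{(\gamma,\beta)\in\mathbb R^2:\ \rho_{\gamma,\beta}(\mathcal Q_{\mu,L})\le\rho\}$. $\Omega_{\mathrm{cv}}(\mathcal Q_{\mu,L})=\{(\gamma,\beta):\rho_{\gamma,\beta}(\mathcal Q_{\mu,L})<1\}=\{(\gamma,\beta):\beta\in(-1,1),\ 0<\gamma<\frac2L(1+\beta)\}$. Cycles: for $K$ points $(x_0,\dots,x_{K-1})$ not all equal, $\mathrm{HB}_{\gamma,\beta}(f)$ cycles on $(x_0,\dots,x_{K-1})$ if the sequence $(z_t)$ generated by $\mathrm{HB}_{\gamma,\beta}(f)$ from $z_0=x_0$, $z_1=x_1$ satisfies $z_t=x_{t\bmod K}$ for all $t\ge0$. For $K\ge2$ let $x_t^\circ=(\cos(2\pi t/K),\sin(2\pi t/K))^\top\in\mathbb R^2$, $t=0,\dots,K-1$; $\Omega_{K\text{-}\circ}(\mathcal F_{\mu,L})$ is the set of $(\gamma,\beta)\in\Omega_{\mathrm{cv}}(\mathcal Q_{\mu,L})$ for which there exists $f\in\mathcal F_{\mu,L}$ on $\mathbb R^2$ such that $\mathrm{HB}_{\gamma,\beta}(f)$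 cycles on $(x_0^\circ,\dots,x_{K-1}^\circ)$. $\Omega_\circ(\mathcal F_{\mu,L})=\bigcup_{K\ge2}\Omega_{K\text{-}\circ}(\mathcal F_{\mu,L})$ and $(\Omega_\circ(\mathcal F_{\mu,L}))^c=\Omega_{\mathrm{cv}}(\mathcal Q_{\mu,L})\setminus\Omega_\circ(\mathcal F_{\mu,L})$. *)

theory Defs
  imports "HOL-Analysis.Analysis"
begin

text \<open>
  The space \<open>R^d\<close> is \<^typ>\<open>real^'n\<close> with \<open>d = CARD('n)\<close>, so that \<open>'n\<close> ranging over all finite types
  amounts to \<open>d \<ge> 1\<close> being arbitrary. Notions that depend on \<open>d\<close> but not on a function take an
  argument of type \<^typ>\<open>'n itself\<close>.
\<close>

definition grad :: "('a::real_inner \<Rightarrow> real) \<Rightarrow> 'a \<Rightarrow> 'a" where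
  "grad f x = (THE g. GDERIV f x :> g)"

definition F_class :: "real \<Rightarrow> real \<Rightarrow> (real^'n \<Rightarrow> real) set" where
  "F_class \<mu> L = {f.
     (\<forall>x. f differentiable (at x)) \<and> continuous_on UNIV (grad f) \<and>
     (\<forall>x y. f x \<le> f y + grad f y \<bullet> (x - y) + L / 2 * (norm (x - y))\<^sup>2) \<and>
     (\<forall>x y. f x \<ge> f y + grad f y \<bullet> (x - y) + \<mu> / 2 * (norm (x - y))\<^sup>2)}"

text \<open>Only used for symmetric matrices, whose complex spectrum is real.\<close>

definition spectrum :: "real^'n^'n \<Rightarrow> real set" where
  "spectrum H = {l. \<exists>v. v \<noteq> 0 \<and> H *v v = l *\<^sub>R v}"

definition Q_class :: "real \<Rightarrow> real \<Rightarrow> (real^'n \<Rightarrow> real) set" where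
  "Q_class \<mu> L = {f \<in> F_class \<mu> L.
     \<exists>H b c. transpose H = H \<and> spectrum H \<subseteq> {\<mu>..L} \<and>
             (\<forall>x. f x = 1 / 2 * (x \<bullet> (H *v x)) + b \<bullet> x + c)}"

fun HB :: "real \<Rightarrow> real \<Rightarrow> (real^'n \<Rightarrow> real) \<Rightarrow> real^'n \<Rightarrow> real^'n \<Rightarrow> nat \<Rightarrow> real^'n" where
  "HB \<gamma> \<beta> f x0 x1 0 = x0"
| "HB \<gamma> \<beta> f x0 x1 (Suc 0) = x1"
| "HB \<gamma> \<beta> f x0 x1 (Suc (Suc t)) =
     HB \<gamma> \<beta> f x0 x1 (Suc t) - \<gamma> *\<^sub>R grad f (HB \<gamma> \<beta> f x0 x1 (Suc t))
       + \<beta> *\<^sub>R (HB \<gamma> \<beta> f x0 x1 (Suc t) - HB \<gamma> \<beta> f x0 x1 t)"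

definition has_rate :: "real \<Rightarrow> real \<Rightarrow> (real^'n \<Rightarrow> real) set \<Rightarrow> real \<Rightarrow> bool" where
  "has_rate \<gamma> \<beta> F \<rho> \<longleftrightarrow> \<rho> \<ge> 0 \<and>
     (\<forall>\<epsilon>>0. \<exists>T0. \<forall>f\<in>F. \<forall>xs. is_arg_min f (\<lambda>_. True) xs \<longrightarrow>
        (\<forall>x0 x1. \<forall>T\<ge>T0. norm (HB \<gamma> \<beta> f x0 x1 T - xs)
           \<le> (\<rho> + \<epsilon>) ^ T * sqrt ((norm (x0 - xs))\<^sup>2 + (norm (x1 - xs))\<^sup>2)))"

text \<open>The infimum is a minimum whenever some rate exists, see \<open>rate_le_iff\<close> below;
  otherwise it is \<open>\<infinity>\<close>.\<close>

definition rate :: "real \<Rightarrow> real \<Rightarrow> (real^'n \<Rightarrow> real) set \<Rightarrow> ereal" where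
  "rate \<gamma> \<beta> F = Inf {ereal \<rho> | \<rho>. has_rate \<gamma> \<beta> F \<rho>}"

definition SLS :: "'n::finite itself \<Rightarrow> real \<Rightarrow> real \<Rightarrow> real \<Rightarrow> (real \<times> real) set" where
  "SLS (_ :: 'n itself) \<mu> L \<rho> =
     {(\<gamma>, \<beta>). rate \<gamma> \<beta> (Q_class \<mu> L :: (real^'n \<Rightarrow> real) set) \<le> ereal \<rho>}"

definition Omega_cv :: "'n::finite itself \<Rightarrow> real \<Rightarrow> real \<Rightarrow> (real \<times> real) set" where
  "Omega_cv (_ :: 'n itself) \<mu> L =
     {(\<gamma>, \<beta>). rate \<gamma> \<beta> (Q_class \<mu> L :: (real^'n \<Rightarrow> real) set) < 1}"

definition cycles_on :: "real \<Rightarrow> real \<Rightarrow> (real^'n \<Rightarrow> real) \<Rightarrow> nat \<Rightarrow> (nat \<Rightarrow> real^'n) \<Rightarrow> bool" where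
  "cycles_on \<gamma> \<beta> f K x \<longleftrightarrow>
     (\<exists>i<K. \<exists>j<K. x i \<noteq> x j) \<and> (\<forall>t. HB \<gamma> \<beta> f (x 0) (x 1) t = x (t mod K))"

definition circle_pt :: "nat \<Rightarrow> nat \<Rightarrow> real^2" where
  "circle_pt K t = vector [cos (2 * pi * real t / real K), sin (2 * pi * real t / real K)]"

definition Omega_K_circ :: "'n::finite itself \<Rightarrow> nat \<Rightarrow> real \<Rightarrow> real \<Rightarrow> (real \<times> real) set" where
  "Omega_K_circ N K \<mu> L = {(\<gamma>, \<beta>) \<in> Omega_cv N \<mu> L.
     \<exists>f \<in> (F_class \<mu> L :: (real^2 \<Rightarrow> real) set). cycles_on \<gamma> \<beta> f K (circle_pt K)}"

definition Omega_circ :: "'n::finite itself \<Rightarrow> real \<Rightarrow> real \<Rightarrow> (real \<times> real) set" where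
  "Omega_circ N \<mu> L = (\<Union>K\<in>{2..}. Omega_K_circ N K \<mu> L)"

definition Omega_circ_compl :: "'n::finite itself \<Rightarrow> real \<Rightarrow> real \<Rightarrow> (real \<times> real) set" where
  "Omega_circ_compl N \<mu> L = Omega_cv N \<mu> L - Omega_circ N \<mu> L"

lemma has_rate_nonneg: "has_rate \<gamma> \<beta> F \<rho> \<Longrightarrow> 0 \<le> \<rho>"
  unfolding has_rate_def by (rule conjunct1)

lemma has_rate_mono:
  assumes "has_rate \<gamma> \<beta> F \<rho>" and "\<rho> \<le> \<rho>'"
  shows "has_rate \<gamma> \<beta> F \<rho>'"
  unfolding has_rate_def
proof (intro conjI allI impI)
  show "\<rho>' \<ge> 0" using has_rate_nonneg[OF assms(1)] assms(2) by linarith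
  fix \<epsilon> :: real assume "\<epsilon> > 0"
  with assms(1) obtain T0 where T0: "\<forall>f\<in>F. \<forall>xs. is_arg_min f (\<lambda>_. True) xs \<longrightarrow>
        (\<forall>x0 x1. \<forall>T\<ge>T0. norm (HB \<gamma> \<beta> f x0 x1 T - xs)
           \<le> (\<rho> + \<epsilon>) ^ T * sqrt ((norm (x0 - xs))\<^sup>2 + (norm (x1 - xs))\<^sup>2))"
    unfolding has_rate_def by blast
  have le: "(\<rho> + \<epsilon>) ^ T * sqrt s \<le> (\<rho>' + \<epsilon>) ^ T * sqrt s" if "s \<ge> 0" for T s
    using assms(2) has_rate_nonneg[OF assms(1)] \<open>\<epsilon> > 0\<close> that
    by (intro mult_right_mono power_mono) auto
  show "\<exists>T0. \<forall>f\<in>F. \<forall>xs. is_arg_min f (\<lambda>_. True) xs \<longrightarrow>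
        (\<forall>x0 x1. \<forall>T\<ge>T0. norm (HB \<gamma> \<beta> f x0 x1 T - xs)
           \<le> (\<rho>' + \<epsilon>) ^ T * sqrt ((norm (x0 - xs))\<^sup>2 + (norm (x1 - xs))\<^sup>2))"
  proof (rule exI[of _ T0], intro ballI allI impI)
    fix f xs x0 x1 T
    assume "f \<in> F" "is_arg_min f (\<lambda>_. True) xs" "T \<ge> T0"
    with T0 have "norm (HB \<gamma> \<beta> f x0 x1 T - xs)
           \<le> (\<rho> + \<epsilon>) ^ T * sqrt ((norm (x0 - xs))\<^sup>2 + (norm (x1 - xs))\<^sup>2)"
      by blast
    also have "\<dots> \<le> (\<rho>' + \<epsilon>) ^ T * sqrt ((norm (x0 - xs))\<^sup>2 + (norm (x1 - xs))\<^sup>2)"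
      by (rule le) simp
    finally show "norm (HB \<gamma> \<beta> f x0 x1 T - xs)
           \<le> (\<rho>' + \<epsilon>) ^ T * sqrt ((norm (x0 - xs))\<^sup>2 + (norm (x1 - xs))\<^sup>2)" .
  qed
qed

lemma rate_le_iff: "rate \<gamma> \<beta> F \<le> ereal \<rho> \<longleftrightarrow> has_rate \<gamma> \<beta> F \<rho>"
proof
  assume "has_rate \<gamma> \<beta> F \<rho>"
  then show "rate \<gamma> \<beta> F \<le> ereal \<rho>" unfolding rate_def by (intro Inf_lower) blast
next
  assume le: "rate \<gamma> \<beta> F \<le> ereal \<rho>"
  have near: "has_rate \<gamma> \<beta> F (\<rho> + \<delta>)" if "\<delta> > 0" for \<delta>
  proof -
    have "rate \<gamma> \<beta> F < ereal (\<rho> + \<delta>)" by (rule le_less_trans[OF le]) (use that in simp)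
    then obtain r where "has_rate \<gamma> \<beta> F r" "r < \<rho> + \<delta>"
      unfolding rate_def Inf_less_iff by (elim bexE CollectE exE conjE) simp
    then show ?thesis by (intro has_rate_mono[of _ _ _ r \<open>\<rho> + \<delta>\<close>]) linarith+
  qed
  show "has_rate \<gamma> \<beta> F \<rho>"
    unfolding has_rate_def
  proof (intro conjI allI impI)
    have "0 \<le> \<rho> + \<delta>" if "\<delta> > 0" for \<delta>
      using near[OF that] by (rule has_rate_nonneg)
    then show "\<rho> \<ge> 0" by (rule field_le_epsilon)
    fix \<epsilon> :: real assume "\<epsilon> > 0"
    then have pos: "\<epsilon> / 2 > 0" by simp
    from near[OF pos] pos have "\<exists>T0. \<forall>f\<in>F. \<forall>xs. is_arg_min f (\<lambda>_. True) xs \<longrightarrow>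
        (\<forall>x0 x1. \<forall>T\<ge>T0. norm (HB \<gamma> \<beta> f x0 x1 T - xs)
           \<le> (\<rho> + \<epsilon> / 2 + \<epsilon> / 2) ^ T * sqrt ((norm (x0 - xs))\<^sup>2 + (norm (x1 - xs))\<^sup>2))"
      unfolding has_rate_def by blast
    also have "\<rho> + \<epsilon> / 2 + \<epsilon> / 2 = \<rho> + \<epsilon>" by simp
    finally show "\<exists>T0. \<forall>f\<in>F. \<forall>xs. is_arg_min f (\<lambda>_. True) xs \<longrightarrow>
        (\<forall>x0 x1. \<forall>T\<ge>T0. norm (HB \<gamma> \<beta> f x0 x1 T - xs)
           \<le> (\<rho> + \<epsilon>) ^ T * sqrt ((norm (x0 - xs))\<^sup>2 + (norm (x1 - xs))\<^sup>2))" .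
  qed
qed

end

theory Submission
  imports Defs
begin

text \<open>
  Testing a rate \<open>\<rho>\<close> on the quadratics of curvature \<open>\<mu>\<close> and \<open>L\<close> gives \<open>\<bar>\<beta>\<bar> \<le> \<rho>\<^sup>2\<close>,
  \<open>(1 - \<rho>) (\<rho> - \<beta>) \<le> \<gamma> \<mu> \<rho>\<close> and \<open>\<gamma> L \<rho> \<le> (1 + \<rho>) (\<rho> + \<beta>)\<close>. Since \<open>1 - \<rho> = C \<kappa> (1 + \<rho>)\<close>,
  these force \<open>C (1 - \<beta>) \<le> \<gamma> L \<le> 4\<close> and a small \<open>\<kappa>\<close>.

  On the other hand, take for \<open>P\<close> the regular \<open>K\<close>-gon with vertices \<open>w x\<^sub>t\<close>, where the complex
  number \<open>w\<close> is determined by requiring that a gradient \<open>\<mu> x + (L - \<mu>) proj\<^sub>P x\<close> with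
  \<open>proj\<^sub>P x\<^sub>t = w x\<^sub>t\<close> makes heavy ball cycle. That \<open>w x\<^sub>t\<close> is indeed the projection of \<open>x\<^sub>t\<close>
  amounts to a quadratic inequality in \<open>\<gamma> L\<close>, which holds as soon as
  \<open>\<gamma> L / 10 \<le> 1 - cos (2 \<pi> / K) \<le> 2 \<gamma> L / 5\<close>; some \<open>K\<close> of the form \<open>3 \<cdot> 2\<^sup>j\<close> satisfies this.
\<close>

section \<open>Gradients from quadratic bounds\<close>

lemma grad_eqI:
  assumes "GDERIV f x :> g"
  shows "grad f x = g"
  unfolding grad_def
proof (rule the_equality, rule assms)
  fix g' assume "GDERIV f x :> g'"
  then have "(\<lambda>h. h \<bullet> g') = (\<lambda>h. h \<bullet> g)"
    using assms unfolding gderiv_def by (rule has_derivative_unique)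
  from fun_cong[OF this, of "g' - g"] have "(g' - g) \<bullet> (g' - g) = 0"
    by (simp add: inner_diff_right)
  then show "g' = g" by simp
qed

lemma GDERIV_quadratic_bound:
  fixes f :: "'a::real_inner \<Rightarrow> real"
  assumes "\<And>y. \<bar>f y - f x - g \<bullet> (y - x)\<bar> \<le> M * (norm (y - x))\<^sup>2"
  shows "GDERIV f x :> g"
  unfolding gderiv_def
proof (rule has_derivativeI_sandwich[of 1 _ _ _ _ "\<lambda>y. M * norm (y - x)"])
  show "bounded_linear (\<lambda>h. h \<bullet> g)" by (rule bounded_linear_inner_left)
  show "((\<lambda>y. M * norm (y - x)) \<longlongrightarrow> 0) (at x)"
    by (rule tendsto_mult_right_zero[OF tendsto_norm_zero[OF LIM_zero[OF tendsto_ident_at]]])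
  fix y assume "y \<noteq> x"
  with assms[of y] show "norm (f y - f x - (y - x) \<bullet> g) / norm (y - x) \<le> M * norm (y - x)"
    by (simp add: inner_commute divide_le_eq power2_eq_square mult.assoc)
qed simp

text \<open>The two inequalities confine the first-order remainder of \<open>f\<close> at
  \<open>y\<close> between \<open>0\<close> and \<open>L / 2 * (norm (x - y))\<^sup>2\<close>, so
  \<open>G\<close> must be the gradient and \<open>f\<close> need not be differentiated by
  hand.\<close>

lemma F_classI:
  fixes f :: "real^'n \<Rightarrow> real"
  assumes "0 \<le> \<mu>" and cont: "continuous_on UNIV G"
    and up: "\<And>x y. f x \<le> f y + G y \<bullet> (x - y) + L / 2 * (norm (x - y))\<^sup>2"
    and lo: "\<And>x y. f x \<ge> f y + G y \<bullet> (x - y) + \<mu> / 2 * (norm (x - y))\<^sup>2"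
  shows "f \<in> F_class \<mu> L" and "grad f = G"
proof -
  have D: "GDERIV f y :> G y" for y
  proof (rule GDERIV_quadratic_bound)
    fix x
    have "0 \<le> \<mu> / 2 * (norm (x - y))\<^sup>2" using assms(1) by simp
    then show "\<bar>f x - f y - G y \<bullet> (x - y)\<bar> \<le> L / 2 * (norm (x - y))\<^sup>2"
      using up[of x y] lo[of y x] lo[where x = x and y = y] by linarith
  qed
  then show G: "grad f = G" by (intro ext grad_eqI)
  have diff: "f differentiable (at x)" for x
    using D unfolding gderiv_def differentiable_def by blast
  show "f \<in> F_class \<mu> L"
    unfolding F_class_def mem_Collect_eq G by (intro conjI allI diff cont up lo)
qed

section \<open>Consequences of a rate on quadratics\<close>

text \<open>These are the test functions for rates: on them heavy ball is one scalar recurrence,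
  with coefficients \<open>1 + \<beta> - \<gamma> * \<eta>\<close> and \<open>- \<beta>\<close>, in
  every direction.\<close>

lemma scaled_square_norm:
  fixes \<eta> \<mu> L :: real
  assumes "0 \<le> \<mu>" "\<mu> \<le> \<eta>" "\<eta> \<le> L"
  defines "f \<equiv> \<lambda>x::real^'n. \<eta> / 2 * (x \<bullet> x)"
  shows "f \<in> Q_class \<mu> L" and "grad f = (\<lambda>x. \<eta> *\<^sub>R x)"
proof -
  have eq: "f x = f y + (\<eta> *\<^sub>R y) \<bullet> (x - y) + \<eta> / 2 * (norm (x - y))\<^sup>2" for x y
    unfolding f_def power2_norm_eq_inner
    by (simp add: inner_diff_left inner_diff_right inner_commute field_simps)
  have up: "f x \<le> f y + (\<eta> *\<^sub>R y) \<bullet> (x - y) + L / 2 * (norm (x - y))\<^sup>2" for x y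
    using eq[of x y] mult_right_mono[OF assms(3), of "(norm (x - y))\<^sup>2"] by simp
  have lo: "f x \<ge> f y + (\<eta> *\<^sub>R y) \<bullet> (x - y) + \<mu> / 2 * (norm (x - y))\<^sup>2" for x y
    using eq[of x y] mult_right_mono[OF assms(2), of "(norm (x - y))\<^sup>2"] by simp
  have cont: "continuous_on UNIV (\<lambda>x::real^'n. \<eta> *\<^sub>R x)" by (intro continuous_intros)
  note F = F_classI[of \<mu> "\<lambda>x. \<eta> *\<^sub>R x" f L, OF assms(1) cont up lo]
  show "grad f = (\<lambda>x. \<eta> *\<^sub>R x)" by (rule F)
  have H: "(\<eta> *\<^sub>R mat 1) *v x = \<eta> *\<^sub>R x" for x :: "real^'n"
    by (simp add: scaleR_matrix_vector_assoc[symmetric])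
  have "transpose (\<eta> *\<^sub>R mat 1 :: real^'n^'n) = \<eta> *\<^sub>R mat 1"
    by (simp add: transpose_scalar)
  moreover have "spectrum (\<eta> *\<^sub>R mat 1 :: real^'n^'n) \<subseteq> {\<mu>..L}"
    unfolding spectrum_def H using assms by auto
  moreover have "f x = 1 / 2 * (x \<bullet> ((\<eta> *\<^sub>R mat 1) *v x)) + 0 \<bullet> x + 0" for x
    unfolding H f_def by simp
  ultimately show "f \<in> Q_class \<mu> L" unfolding Q_class_def using F(1) by blast
qed

text \<open>A constant factor cannot offset a larger base. This discards the dependence of a rate
  bound on the initial points.\<close>

lemma power_le_const_imp_le:
  fixes p q c :: real
  assumes "0 \<le> p" "0 < q" and le: "\<And>n. n \<ge> N \<Longrightarrow> p ^ n \<le> c * q ^ n"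
  shows "p \<le> q"
proof (rule ccontr)
  assume "\<not> p \<le> q"
  then have "1 < p / q" using assms by simp
  then obtain n where n: "c < (p / q) ^ n" using real_arch_pow by blast
  have "(p / q) ^ n \<le> (p / q) ^ (n + N)"
    using \<open>1 < p / q\<close> by (intro power_increasing) auto
  then have "c < p ^ (n + N) / q ^ (n + N)" using n by (simp add: power_divide)
  then have "c * q ^ (n + N) < p ^ (n + N)" using assms(2) by (simp add: pos_less_divide_eq)
  then show False using le[of "n + N"] by simp
qed

text \<open>The momentum bound covers complex characteristic roots: the Casoratian of two solutions of the
  scalar recurrence is multiplied by \<open>\<beta>\<close> at each step.\<close>

lemma has_rate_quadratic:
  fixes \<mu> L \<eta> :: real
  assumes rate: "has_rate \<gamma> \<beta> (Q_class \<mu> L :: (real^'n \<Rightarrow> real) set) \<rho>"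
    and \<eta>: "0 \<le> \<mu>" "\<mu> \<le> \<eta>" "\<eta> \<le> L"
  shows has_rate_real_root: "r\<^sup>2 - (1 + \<beta> - \<gamma> * \<eta>) * r + \<beta> = 0 \<Longrightarrow> \<bar>r\<bar> \<le> \<rho>"
    and has_rate_momentum: "\<bar>\<beta>\<bar> \<le> \<rho>\<^sup>2"
proof -
  define f where "f = (\<lambda>x::real^'n. \<eta> / 2 * (x \<bullet> x))"
  note f = scaled_square_norm[where 'n = 'n, OF \<eta>, folded f_def]
  have rho: "0 \<le> \<rho>" using rate by (rule has_rate_nonneg)
  have "f 0 \<le> f x" for x using \<eta> by (simp add: f_def)
  then have min: "is_arg_min f (\<lambda>_. True) 0" by (auto simp: is_arg_min_linorder)
  obtain v :: "real^'n" where v: "norm v = 1" by (metis vector_choose_size zero_le_one)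
  have bnd: "\<exists>T0. \<forall>x0 x1. \<forall>T\<ge>T0.
      norm (HB \<gamma> \<beta> f x0 x1 T) \<le> q ^ T * sqrt ((norm x0)\<^sup>2 + (norm x1)\<^sup>2)" if "\<rho> < q" for q
  proof -
    have "0 < q - \<rho>" using that by simp
    then obtain T0 where T0: "\<forall>g\<in>Q_class \<mu> L. \<forall>xs. is_arg_min g (\<lambda>_. True) xs \<longrightarrow>
        (\<forall>(x0::real^'n) x1. \<forall>T\<ge>T0. norm (HB \<gamma> \<beta> g x0 x1 T - xs)
           \<le> (\<rho> + (q - \<rho>)) ^ T * sqrt ((norm (x0 - xs))\<^sup>2 + (norm (x1 - xs))\<^sup>2))"
      using rate unfolding has_rate_def by blast
    from T0[rule_format, OF f(1) min] show ?thesis by auto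
  qed
  {
    assume r: "r\<^sup>2 - (1 + \<beta> - \<gamma> * \<eta>) * r + \<beta> = 0"
    \<comment> \<open>A real characteristic root gives a geometric orbit, whose growth is then
      compared with \<open>q ^ T\<close> for every \<open>q > \<rho>\<close>.\<close>
    have HB: "HB \<gamma> \<beta> f v (r *\<^sub>R v) t = r ^ t *\<^sub>R v" for t
    proof (induction t rule: induct_nat_012)
      case (ge2 t)
      have "r ^ Suc (Suc t) = r ^ t * ((1 + \<beta> - \<gamma> * \<eta>) * r - \<beta>)"
        using r by (simp add: power2_eq_square)
      then show ?case
        unfolding HB.simps ge2 f(2) by (simp add: algebra_simps flip: scaleR_add_left scaleR_diff_left)
    qed auto
    show "\<bar>r\<bar> \<le> \<rho>"
    proof (rule dense_ge)
      fix q assume q: "\<rho> < q"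
      then obtain T0 where T0: "\<And>T. T \<ge> T0 \<Longrightarrow>
          norm (HB \<gamma> \<beta> f v (r *\<^sub>R v) T) \<le> q ^ T * sqrt ((norm v)\<^sup>2 + (norm (r *\<^sub>R v))\<^sup>2)"
        using bnd by blast
      show "\<bar>r\<bar> \<le> q"
      proof (rule power_le_const_imp_le)
        show "\<bar>r\<bar> ^ n \<le> sqrt ((norm v)\<^sup>2 + (norm (r *\<^sub>R v))\<^sup>2) * q ^ n" if "n \<ge> T0" for n
          using T0[OF that] unfolding HB by (simp add: v power_abs mult.commute)
      qed (use q rho in auto)
    qed
  }
  \<comment> \<open>Fundamental solutions started from \<open>(1, 0)\<close> and
    \<open>(0, 1)\<close>, so that their Casoratian starts at \<open>1\<close>. It is quadratic in
    the orbits, hence of order \<open>q\<^sup>2\<close> per step.\<close>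
  define X where "X = (\<lambda>t. v \<bullet> HB \<gamma> \<beta> f v 0 t)"
  define Y where "Y = (\<lambda>t. v \<bullet> HB \<gamma> \<beta> f 0 v t)"
  have casoratian: "X t * Y (Suc t) - X (Suc t) * Y t = \<beta> ^ t" for t
  proof (induction t)
    case 0
    then show ?case using v by (simp add: X_def Y_def norm_eq_1)
  next
    case (Suc t)
    have step: "X (Suc (Suc t)) = (1 + \<beta> - \<gamma> * \<eta>) * X (Suc t) - \<beta> * X t"
      "Y (Suc (Suc t)) = (1 + \<beta> - \<gamma> * \<eta>) * Y (Suc t) - \<beta> * Y t"
      by (simp_all add: X_def Y_def f(2) algebra_simps)
    have "X (Suc t) * Y (Suc (Suc t)) - X (Suc (Suc t)) * Y (Suc t)
        = \<beta> * (X t * Y (Suc t) - X (Suc t) * Y t)"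
      unfolding step by (simp add: algebra_simps)
    then show ?case using Suc by simp
  qed
  have beta_q: "\<bar>\<beta>\<bar> \<le> q\<^sup>2" if q: "\<rho> < q" for q
  proof -
    obtain T0 where T0: "\<And>x0 x1 T. T \<ge> T0 \<Longrightarrow>
        norm (HB \<gamma> \<beta> f x0 x1 T) \<le> q ^ T * sqrt ((norm x0)\<^sup>2 + (norm x1)\<^sup>2)"
      using bnd q by blast
    have XY: "\<bar>X T\<bar> \<le> q ^ T" "\<bar>Y T\<bar> \<le> q ^ T" if "T \<ge> T0" for T
      using T0[OF that, of v 0] T0[OF that, of 0 v] v
        Cauchy_Schwarz_ineq2[of v "HB \<gamma> \<beta> f v 0 T"] Cauchy_Schwarz_ineq2[of v "HB \<gamma> \<beta> f 0 v T"]
      unfolding X_def Y_def by auto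
    show ?thesis
    proof (rule power_le_const_imp_le)
      fix n assume n: "n \<ge> T0"
      have "\<bar>X n\<bar> * \<bar>Y (Suc n)\<bar> \<le> q ^ n * q ^ Suc n" "\<bar>X (Suc n)\<bar> * \<bar>Y n\<bar> \<le> q ^ Suc n * q ^ n"
        using XY[of n] XY[of "Suc n"] n q rho by (auto intro!: mult_mono)
      then have "\<bar>X n * Y (Suc n) - X (Suc n) * Y n\<bar> \<le> q ^ n * q ^ Suc n + q ^ Suc n * q ^ n"
        unfolding abs_mult[symmetric] by linarith
      also have "\<dots> = 2 * q * (q\<^sup>2) ^ n" by (simp add: power_mult_distrib power2_eq_square)
      finally show "\<bar>\<beta>\<bar> ^ n \<le> 2 * q * (q\<^sup>2) ^ n" unfolding casoratian power_abs .
    qed (use q rho in auto)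
  qed
  have "sqrt \<bar>\<beta>\<bar> \<le> \<rho>"
  proof (rule dense_ge)
    fix q assume "\<rho> < q"
    then show "sqrt \<bar>\<beta>\<bar> \<le> q" using beta_q rho by (intro real_le_lsqrt) auto
  qed
  then show "\<bar>\<beta>\<bar> \<le> \<rho>\<^sup>2" using rho by (simp add: sqrt_le_D)
qed

text \<open>A negative value at \<open>y\<close> would produce real roots on both sides of
  \<open>y\<close>, and the one farther from \<open>0\<close> would have modulus above
  \<open>x\<close>. Without real roots the quadratic is positive everywhere.\<close>

lemma quadratic_nonneg_above_roots:
  fixes b c x :: real
  assumes roots: "\<And>r. r\<^sup>2 - b * r + c = 0 \<Longrightarrow> \<bar>r\<bar> \<le> x" and "\<bar>y\<bar> = x"
  shows "y\<^sup>2 - b * y + c \<ge> 0"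
proof (rule ccontr)
  assume neg: "\<not> ?thesis"
  define d where "d = b\<^sup>2 / 4 - c"
  have sq: "z\<^sup>2 - b * z + c = (z - b / 2)\<^sup>2 - d" for z
    by (simp add: d_def power2_eq_square field_simps)
  then have "(y - b / 2)\<^sup>2 < d" using neg by simp
  moreover then have "0 \<le> d" using zero_le_power2[of "y - b / 2"] by linarith
  ultimately have "\<bar>y - b / 2\<bar> < sqrt d" by (metis real_less_rsqrt power2_abs)
  moreover have "\<bar>b / 2 + sqrt d\<bar> \<le> x" "\<bar>b / 2 - sqrt d\<bar> \<le> x"
    by (rule roots; simp add: sq \<open>0 \<le> d\<close>)+
  ultimately show False using assms(2) by linarith
qed

text \<open>This translates a rate into what the choice of the polygon and the circle condition ask
  of the parameters.\<close>

lemma SLS_bounds: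
  fixes \<mu> L C :: real
  assumes C: "C \<ge> 50/3" and \<mu>: "0 < \<mu>" "\<mu> < L"
    and rate: "has_rate \<gamma> \<beta> (Q_class \<mu> L :: (real^'n \<Rightarrow> real) set)
                  ((1 - C * (\<mu> / L)) / (1 + C * (\<mu> / L)))"
  shows "0 < \<beta>" "\<beta> < 1" "50/3 * (1 - \<beta>) \<le> \<gamma> * L" "\<gamma> * L \<le> 4" "\<mu> / L \<le> 1/25"
proof -
  define k where "k = \<mu> / L"
  define a where "a = \<gamma> * L"
  define \<rho> where "\<rho> = (1 - C * k) / (1 + C * k)"
  have k: "0 < k" using \<mu> by (simp add: k_def)
  have ga: "\<gamma> * \<mu> = k * a" using \<mu> by (simp add: k_def a_def)
  have Ck: "0 < C * k" using k C by simp
  have rho1: "(1 - \<rho>) = C * k * (1 + \<rho>)" using Ck by (simp add: \<rho>_def field_simps)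
  note rate = rate[folded k_def, folded \<rho>_def]
  have rho0: "0 \<le> \<rho>" using rate by (rule has_rate_nonneg)
  have rho_lt: "\<rho> < 1" using Ck by (simp add: \<rho>_def field_simps)
  note bm = has_rate_momentum[OF rate, of L]
  have beta: "\<bar>\<beta>\<bar> \<le> \<rho>\<^sup>2" using \<mu> by (intro bm) auto
  have pm: "\<rho>\<^sup>2 - (1 + \<beta> - \<gamma> * \<mu>) * \<rho> + \<beta> \<ge> 0"
    by (rule quadratic_nonneg_above_roots[of _ _ \<rho>])
       (use has_rate_real_root[OF rate, of \<mu>] \<mu> rho0 in auto)
  have pL: "(-\<rho>)\<^sup>2 - (1 + \<beta> - \<gamma> * L) * (-\<rho>) + \<beta> \<ge> 0"
    by (rule quadratic_nonneg_above_roots[of _ _ \<rho>])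
       (use has_rate_real_root[OF rate, of L] \<mu> rho0 in auto)
  \<comment> \<open>The characteristic polynomial for \<open>\<mu>\<close> at \<open>\<rho>\<close>
    is \<open>\<gamma> * \<mu> * \<rho> - (1 - \<rho>) * (\<rho> - \<beta>)\<close>, and the one for
    \<open>L\<close> at \<open>- \<rho>\<close> is
    \<open>(1 + \<rho>) * (\<rho> + \<beta>) - \<gamma> * L * \<rho>\<close>.\<close>
  have m1: "k * a * \<rho> \<ge> (1 - \<rho>) * (\<rho> - \<beta>)"
    using pm unfolding ga by (simp add: algebra_simps power2_eq_square)
  have L1: "a * \<rho> \<le> (1 + \<rho>) * (\<rho> + \<beta>)"
    using pL unfolding a_def by (simp add: algebra_simps power2_eq_square)
  \<comment> \<open>Rate \<open>0\<close> would force \<open>\<beta> = 0\<close> and then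
    \<open>\<gamma> * l = 1\<close> for both \<open>l = \<mu>\<close> and
    \<open>l = L\<close>.\<close>
  have "\<rho> \<noteq> 0"
  proof
    assume "\<rho> = 0"
    then have "\<beta> = 0" using beta by simp
    have "1 - \<gamma> * l = 0" if "\<mu> \<le> l" "l \<le> L" for l
      using has_rate_real_root[OF rate, of l "1 - \<gamma> * l"] that \<mu> \<open>\<rho> = 0\<close> \<open>\<beta> = 0\<close>
      by (simp add: power2_eq_square)
    from this[of \<mu>] this[of L] \<mu> have "\<gamma> * \<mu> = \<gamma> * L" "\<gamma> \<noteq> 0" by auto
    then show False using \<mu> by simp
  qed
  then have rho: "0 < \<rho>" using rho0 by simp
  have sq: "\<rho>\<^sup>2 \<le> \<rho>" using rho rho_lt by (simp add: power2_eq_square)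
  \<comment> \<open>Writing \<open>1 - \<rho>\<close> as \<open>C * k * (1 + \<rho>)\<close> puts a
    factor \<open>k\<close> on both sides; cancelling it leaves a bound independent of the
    conditioning.\<close>
  have "k * (C * ((1 + \<rho>) * (\<rho> - \<beta>))) \<le> k * (a * \<rho>)"
    using m1 unfolding rho1 by (simp add: mult_ac)
  then have lower: "C * ((1 + \<rho>) * (\<rho> - \<beta>)) \<le> a * \<rho>" using k by simp
  have "50/3 * ((1 + \<rho>) * (\<rho> - \<beta>)) \<le> C * ((1 + \<rho>) * (\<rho> - \<beta>))"
    using C beta sq rho by (intro mult_right_mono) auto
  with lower have lower': "50/3 * ((1 + \<rho>) * (\<rho> - \<beta>)) \<le> a * \<rho>" by linarith
  have "(1 + \<rho>) * (50/3 * (\<rho> - \<beta>)) \<le> (1 + \<rho>) * (\<rho> + \<beta>)"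
    using order_trans[OF lower' L1] by (simp only: mult_ac)
  then have "50/3 * (\<rho> - \<beta>) \<le> \<rho> + \<beta>" using rho by (subst (asm) mult_le_cancel_left_pos) auto
  then have beta_ge: "47 * \<rho> \<le> 53 * \<beta>" by simp
  then show "0 < \<beta>" using rho by linarith
  show "\<beta> < 1" using beta sq rho_lt by linarith
  have "47 * \<rho> \<le> 53 * \<rho> * \<rho>" using beta_ge beta by (simp add: power2_eq_square)
  then have rho_ge: "47 \<le> 53 * \<rho>" using rho by simp
  \<comment> \<open>The difference
    \<open>(1 + \<rho>) * (\<rho> - \<beta>) - \<rho> * (1 - \<beta>)\<close> equals
    \<open>\<rho>\<^sup>2 - \<beta>\<close>, which the momentum bound makes nonnegative.\<close>
  have "50/3 * (\<rho> * (1 - \<beta>)) \<le> 50/3 * ((1 + \<rho>) * (\<rho> - \<beta>))"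
    using beta by (intro mult_left_mono) (simp_all add: algebra_simps power2_eq_square)
  from order_trans[OF this lower'] have "\<rho> * (50/3 * (1 - \<beta>)) \<le> \<rho> * a"
    by (simp only: mult_ac)
  then show "50/3 * (1 - \<beta>) \<le> \<gamma> * L" using rho unfolding a_def by simp
  have "(1 + \<rho>) * (\<rho> + \<beta>) \<le> 2 * (\<rho> * 2)"
  proof (rule mult_mono)
    show "\<rho> + \<beta> \<le> \<rho> * 2" using beta sq by linarith
  qed (use rho rho_lt beta_ge in auto)
  with L1 have "\<rho> * a \<le> \<rho> * 4" by (simp add: mult_ac)
  then show "\<gamma> * L \<le> 4" using rho unfolding a_def by simp
  have "k * (50/3 * (100/53)) \<le> k * (C * (1 + \<rho>))"
    using rho_ge C k by (intro mult_left_mono mult_mono) auto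
  also have "\<dots> = 1 - \<rho>" unfolding rho1 by (simp only: mult_ac)
  also have "\<dots> \<le> 6/53" using rho_ge by simp
  finally show "\<mu> / L \<le> 1/25" unfolding k_def by simp
qed

section \<open>Projections onto convex sets as gradients\<close>

text \<open>The function below is \<open>L / 2 * \<parallel>x\<parallel>\<^sup>2 - (L - \<mu>) / 2 * dist(x, P)\<^sup>2\<close>.\<close>

lemma squared_dist_to_convex:
  fixes P :: "(real^'n) set" and \<mu> L :: real
  assumes P: "convex P" "closed P" "P \<noteq> {}" and \<mu>: "0 \<le> \<mu>" "\<mu> \<le> L"
  defines "f \<equiv> \<lambda>x. \<mu> / 2 * (norm x)\<^sup>2 +
      (L - \<mu>) * (x \<bullet> closest_point P x - (norm (closest_point P x))\<^sup>2 / 2)"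
  shows "f \<in> F_class \<mu> L"
    and "grad f = (\<lambda>x. \<mu> *\<^sub>R x + (L - \<mu>) *\<^sub>R closest_point P x)"
proof -
  define h where "h x = x \<bullet> closest_point P x - (norm (closest_point P x))\<^sup>2 / 2" for x
  define G where "G x = \<mu> *\<^sub>R x + (L - \<mu>) *\<^sub>R closest_point P x" for x
  have split: "f x - f y - G y \<bullet> (x - y) - \<mu> / 2 * (norm (x - y))\<^sup>2
      = (L - \<mu>) * (h x - h y - closest_point P y \<bullet> (x - y))" for x y
    unfolding f_def h_def G_def power2_norm_eq_inner
    by (simp add: inner_diff_left inner_diff_right inner_add_left inner_add_right inner_commute
        field_simps)
  \<comment> \<open>\<open>h\<close> is half the squared norm minus half the squared distance to
    \<open>P\<close>. The obtuse-angle inequality at the projection of \<open>x\<close> gives the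
    lower bound, the one at the projection of \<open>y\<close> the upper bound.\<close>
  have h: "0 \<le> h x - h y - closest_point P y \<bullet> (x - y)"
    "h x - h y - closest_point P y \<bullet> (x - y) \<le> (norm (x - y))\<^sup>2 / 2" for x y
  proof -
    define p q where "p = closest_point P y" and "q = closest_point P x"
    have pq: "p \<in> P" "q \<in> P" using closest_point_in_set P unfolding p_def q_def by auto
    have "(x - q) \<bullet> (p - q) \<le> 0" "(y - p) \<bullet> (q - p) \<le> 0"
      using closest_point_dot[OF P(1,2)] pq unfolding p_def q_def by auto
    moreover have "0 \<le> (norm (p - q))\<^sup>2" "0 \<le> (norm (x - y - (q - p)))\<^sup>2" by auto
    ultimately show "0 \<le> h x - h y - closest_point P y \<bullet> (x - y)"
      "h x - h y - closest_point P y \<bullet> (x - y) \<le> (norm (x - y))\<^sup>2 / 2"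
      unfolding h_def p_def[symmetric] q_def[symmetric] power2_norm_eq_inner
      by (auto simp: inner_diff_left inner_diff_right inner_add_left inner_add_right inner_commute)
  qed
  have lo: "f x \<ge> f y + G y \<bullet> (x - y) + \<mu> / 2 * (norm (x - y))\<^sup>2" for x y
    using split[of x y] mult_nonneg_nonneg[OF _ h(1), of "L - \<mu>" x y] \<mu>(2) by simp
  have up: "f x \<le> f y + G y \<bullet> (x - y) + L / 2 * (norm (x - y))\<^sup>2" for x y
    using split[of x y] mult_left_mono[OF h(2), of "L - \<mu>" x y] \<mu>(2)
    by (simp add: algebra_simps)
  have "continuous_on UNIV G"
    unfolding G_def by (intro continuous_intros continuous_on_closest_point P)
  from F_classI[OF \<mu>(1) this up lo] show "f \<in> F_class \<mu> L"
    "grad f = (\<lambda>x. \<mu> *\<^sub>R x + (L - \<mu>) *\<^sub>R closest_point P x)"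
    unfolding G_def by auto
qed

text \<open>The obtuse-angle criterion for a projection is affine in \<open>q\<close>, so it extends
  from the generators to the hull.\<close>

lemma closest_point_convex_hull:
  fixes a p :: "'a::euclidean_space"
  assumes "finite S" "p \<in> S" and dot: "\<And>q. q \<in> S \<Longrightarrow> (a - p) \<bullet> (q - p) \<le> 0"
  shows "closest_point (convex hull S) a = p"
proof (rule closest_point_unique[symmetric])
  have "convex hull S \<subseteq> {z. (a - p) \<bullet> z \<le> (a - p) \<bullet> p}"
    using dot by (intro hull_minimal convex_halfspace_le) (auto simp: inner_diff_right)
  then have z: "(a - p) \<bullet> (z - p) \<le> 0" if "z \<in> convex hull S" for z
    using that by (auto simp: inner_diff_right)
  show "\<forall>z\<in>convex hull S. dist a p \<le> dist a z"
  proof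
    fix z assume "z \<in> convex hull S"
    have "(norm (a - z))\<^sup>2 = (norm (a - p))\<^sup>2 + (norm (z - p))\<^sup>2 - 2 * ((a - p) \<bullet> (z - p))"
      unfolding power2_norm_eq_inner
      by (simp add: inner_diff_left inner_diff_right inner_commute)
    then have "(norm (a - p))\<^sup>2 \<le> (norm (a - z))\<^sup>2"
      using z[OF \<open>z \<in> convex hull S\<close>] zero_le_power2[of "norm (z - p)"] by linarith
    then show "dist a p \<le> dist a z" unfolding dist_norm by (simp add: power2_le_iff_abs_le)
  qed
  show "closed (convex hull S)"
    using assms(1) by (simp add: compact_convex_hull compact_imp_closed finite_imp_compact)
qed (use assms(2) in \<open>auto simp: hull_inc\<close>)

section \<open>Heavy ball cycles on the circle\<close>

text \<open>Multiplication by the imaginary unit. The factor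
  \<open>w = \<alpha> - i \<delta>\<close> acts as
  \<open>\<alpha> *\<^sub>R x - \<delta> *\<^sub>R quarter_turn x\<close>.\<close>

definition quarter_turn :: "real^2 \<Rightarrow> real^2" where
  "quarter_turn v = vector [- (v $ 2), v $ 1]"

lemma circle_pt_mod: "circle_pt K (t mod K) = circle_pt K t"
proof (cases "K = 0")
  case False
  have "real t = real (t mod K) + real K * real (t div K)"
    by (metis mod_mult_div_eq of_nat_add of_nat_mult)
  then have eq: "2 * pi * real t / real K
      = 2 * pi * real (t mod K) / real K + real (t div K) * (2 * pi)"
    using False by (simp add: field_simps)
  show ?thesis
    unfolding circle_pt_def eq
    using cos.plus_of_nat[of "2 * pi * real (t mod K) / real K" "t div K"]
      sin.plus_of_nat[of "2 * pi * real (t mod K) / real K" "t div K"] by simp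
qed simp

text \<open>Comparison with the heavy ball step shows that the last two terms are minus
  \<open>\<gamma>\<close> times the gradient needed at \<open>circle_pt K (Suc t)\<close>.\<close>

lemma circle_pt_recurrence:
  fixes \<beta> :: real and K :: nat
  defines "\<theta> \<equiv> 2 * pi / real K"
  shows "circle_pt K (Suc (Suc t)) = (1 + \<beta>) *\<^sub>R circle_pt K (Suc t) - \<beta> *\<^sub>R circle_pt K t
    - ((1 + \<beta>) * (1 - cos \<theta>)) *\<^sub>R circle_pt K (Suc t)
    + ((1 - \<beta>) * sin \<theta>) *\<^sub>R quarter_turn (circle_pt K (Suc t))"
proof -
  define \<phi> where "\<phi> = \<theta> * real (Suc t)"
  have angles: "2 * pi * real (Suc (Suc t)) / real K = \<phi> + \<theta>" "2 * pi * real (Suc t) / real K = \<phi>"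
    "2 * pi * real t / real K = \<phi> - \<theta>"
    by (simp_all add: \<phi>_def \<theta>_def algebra_simps add_divide_distrib diff_divide_distrib)
  show ?thesis
    unfolding circle_pt_def quarter_turn_def angles
    by (simp add: vec_eq_iff forall_2 cos_add sin_add cos_diff sin_diff algebra_simps)
qed

text \<open>The cotangent decreases on \<open>(0, pi)\<close>; with the sines cleared, the endpoint
  \<open>\<psi> = pi\<close> is covered too.\<close>

lemma sin_cot_mono:
  fixes A \<delta> \<phi> \<psi> :: real
  assumes \<phi>: "0 < \<phi>" "\<phi> \<le> \<psi>" "\<psi> \<le> pi" and "0 \<le> \<delta>"
    and le: "\<delta> * cos \<phi> \<le> A * sin \<phi>" and "\<phi> < pi"
  shows "\<delta> * cos \<psi> \<le> A * sin \<psi>"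
proof -
  have pos: "0 < sin \<phi>" "0 \<le> sin \<psi>" "0 \<le> sin (\<psi> - \<phi>)"
    using assms by (auto intro!: sin_gt_zero sin_ge_zero)
  have "\<delta> * (cos \<psi> * sin \<phi>) \<le> \<delta> * (cos \<phi> * sin \<psi>)"
    using pos(3) \<open>0 \<le> \<delta>\<close> by (intro mult_left_mono) (auto simp: sin_diff mult.commute)
  also have "\<dots> \<le> (A * sin \<phi>) * sin \<psi>"
    using mult_right_mono[OF le pos(2)] by (simp add: mult_ac)
  finally have "(\<delta> * cos \<psi>) * sin \<phi> \<le> (A * sin \<psi>) * sin \<phi>" by (simp add: mult_ac)
  then show ?thesis using pos(1) by simp
qed

text \<open>The inner product depends only on the angle \<open>2 * \<psi>\<close> between the
  vertices and equals \<open>2 * sin \<psi> * (\<delta> * cos \<psi> - A * sin \<psi>)\<close>. As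
  the cotangent decreases, the next vertex, \<open>\<psi> = pi / K\<close>, is the critical one, and
  \<open>le\<close> treats it.\<close>

lemma circle_pt_dot:
  fixes \<alpha> \<delta> :: real and K s t :: nat
  assumes K: "2 \<le> K" and "0 \<le> \<delta>" "s < K" "t < K"
    and le: "\<delta> * cos (pi / real K) \<le> (\<alpha> - \<alpha>\<^sup>2 - \<delta>\<^sup>2) * sin (pi / real K)"
  defines "p \<equiv> \<lambda>t. \<alpha> *\<^sub>R circle_pt K t - \<delta> *\<^sub>R quarter_turn (circle_pt K t)"
  shows "(circle_pt K t - p t) \<bullet> (p s - p t) \<le> 0"
proof -
  define A where "A = \<alpha> - \<alpha>\<^sup>2 - \<delta>\<^sup>2"
  define x y where "x = 2 * pi * real t / real K" and "y = 2 * pi * real s / real K"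
  have "(circle_pt K t - p t) \<bullet> (p s - p t)
      = A * (cos (y - x) - ((sin x)\<^sup>2 + (cos x)\<^sup>2)) + \<delta> * sin (y - x)"
    unfolding p_def circle_pt_def quarter_turn_def x_def[symmetric] y_def[symmetric] A_def
      cos_diff sin_diff inner_vec_def sum_2
    by (simp add: algebra_simps power2_eq_square
        del: sin_cos_squared_add sin_cos_squared_add2 sin_cos_squared_add3)
  also have "\<dots> = A * (cos (y - x) - 1) + \<delta> * sin (y - x)" by simp
  also have "\<dots> \<le> 0"
  proof (cases "s = t")
    case False
    \<comment> \<open>The number of steps from \<open>t\<close> forward to \<open>s\<close>, counted
      cyclically so that \<open>\<psi>\<close> stays in \<open>[pi / K, pi]\<close>.\<close>
    define d where "d = (if t < s then s - t else s + K - t)"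
    define \<psi> where "\<psi> = pi * real d / real K"
    have d: "1 \<le> d" "d \<le> K" using False assms by (auto simp: d_def)
    have "real d = real s - real t \<or> real d = real s - real t + real K"
      using False assms by (auto simp: d_def)
    then have "2 * \<psi> = y - x \<or> 2 * \<psi> = y - x + 2 * pi"
    proof (rule disj_forward)
      assume d: "real d = real s - real t"
      show "2 * \<psi> = y - x"
        unfolding \<psi>_def x_def y_def d by (simp add: diff_divide_distrib right_diff_distrib)
    next
      assume d: "real d = real s - real t + real K"
      show "2 * \<psi> = y - x + 2 * pi"
        unfolding \<psi>_def x_def y_def d using K
        by (simp add: diff_divide_distrib add_divide_distrib right_diff_distrib distrib_left)
    qed
    then have trig: "cos (y - x) = cos (2 * \<psi>)" "sin (y - x) = sin (2 * \<psi>)" by auto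
    have psi: "pi / real K \<le> \<psi>" "\<psi> \<le> pi"
      using d K by (auto simp: \<psi>_def field_simps)
    have "\<delta> * cos \<psi> \<le> A * sin \<psi>"
      by (rule sin_cot_mono[of "pi / real K"])
         (use le psi K \<open>0 \<le> \<delta>\<close> in \<open>auto simp: A_def divide_less_eq\<close>)
    moreover have "0 \<le> sin \<psi>"
      using psi by (intro sin_ge_zero) (simp_all add: \<psi>_def)
    ultimately have "2 * sin \<psi> * (\<delta> * cos \<psi>) \<le> 2 * sin \<psi> * (A * sin \<psi>)"
      by (intro mult_left_mono) auto
    then show ?thesis
      unfolding trig cos_double_sin sin_double by (simp add: algebra_simps power2_eq_square)
  qed (simp add: x_def y_def)
  finally show ?thesis .
qed

text \<open>Up to positive factors, \<open>le\<close> is the hypothesis of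
  \<open>circle_pt_dot\<close> for the factor \<open>w\<close> that the recurrence dictates.\<close>

lemma cycles_on_circle:
  fixes \<mu> L \<gamma> \<beta> :: real and K :: nat
  assumes \<mu>: "0 < \<mu>" "\<mu> < L" and K: "3 \<le> K" and "0 < \<gamma>" "\<beta> < 1"
  defines "\<kappa> \<equiv> \<mu> / L" and "a \<equiv> \<gamma> * L" and "c \<equiv> cos (2 * pi / real K)"
  assumes le: "\<kappa> * a\<^sup>2 - 2 * (\<beta> - c + \<kappa> * (1 - \<beta> * c)) * a
                 + 2 * (1 - c) * (1 + \<beta>\<^sup>2 - 2 * \<beta> * c) \<le> 0"
  shows "\<exists>f \<in> (F_class \<mu> L :: (real^2 \<Rightarrow> real) set). cycles_on \<gamma> \<beta> f K (circle_pt K)"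
proof -
  define S C where "S = sin (pi / real K)" and "C = cos (pi / real K)"
  have SC: "C\<^sup>2 = 1 - S\<^sup>2" "c = 1 - 2 * S\<^sup>2" "sin (2 * pi / real K) = 2 * S * C"
    unfolding S_def C_def c_def using cos_double_sin[of "pi / real K"] sin_double[of "pi / real K"]
    by (simp_all add: cos_squared_eq)
  have pos: "0 < a" "0 < \<kappa>" "\<kappa> < 1" "0 < S" "0 \<le> C" "0 < L"
  proof -
    have "pi / real K \<le> pi / 2" using K by (intro divide_left_mono) auto
    moreover have "0 < pi / real K" using K by simp
    ultimately show "0 < S" "0 \<le> C" unfolding S_def C_def
      using pi_gt_zero by (intro sin_gt_zero cos_ge_zero; linarith)+
  qed (use assms in \<open>auto simp: a_def \<kappa>_def\<close>)
  \<comment> \<open>On the circle the gradient must act as \<open>L * (u - i v)\<close>. Solving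
    \<open>u - i v = \<kappa> + (1 - \<kappa>) w\<close> yields
    \<open>w = \<alpha> - i \<delta>\<close>.\<close>
  define u v where "u = (1 + \<beta>) * (1 - c) / a" and "v = (1 - \<beta>) * sin (2 * pi / real K) / a"
  define \<alpha> \<delta> where "\<alpha> = (u - \<kappa>) / (1 - \<kappa>)" and "\<delta> = v / (1 - \<kappa>)"
  have au: "a * u = (1 + \<beta>) * (2 * S\<^sup>2)" and av: "a * v = (1 - \<beta>) * (2 * S * C)"
    using pos by (simp_all add: u_def v_def SC)
  have "0 \<le> \<delta>" using pos \<open>\<beta> < 1\<close> by (simp add: \<delta>_def v_def SC)
  have key: "\<delta> * C \<le> (\<alpha> - \<alpha>\<^sup>2 - \<delta>\<^sup>2) * S"
  proof -
    have "a\<^sup>2 * ((u - \<kappa>) * (1 - u) - v\<^sup>2) = (a * u - \<kappa> * a) * (a - a * u) - (a * v)\<^sup>2"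
      by (simp add: algebra_simps power2_eq_square)
    also have "\<dots> = ((1 + \<beta>) * (2 * S\<^sup>2) - \<kappa> * a) * (a - (1 + \<beta>) * (2 * S\<^sup>2))
        - (1 - \<beta>)\<^sup>2 * (4 * S\<^sup>2 * (1 - S\<^sup>2))"
      unfolding au av by (simp add: power_mult_distrib SC)
    \<comment> \<open>The subtracted parenthesis is the left side of \<open>le\<close>.\<close>
    also have "\<dots> = (1 - \<kappa>) * ((1 - \<beta>) * (2 * (1 - S\<^sup>2))) * a
       - (\<kappa> * a\<^sup>2 - 2 * (\<beta> - c + \<kappa> * (1 - \<beta> * c)) * a + 2 * (1 - c) * (1 + \<beta>\<^sup>2 - 2 * \<beta> * c))"
      unfolding SC by algebra
    finally have "(1 - \<kappa>) * ((1 - \<beta>) * (2 * C\<^sup>2)) * a \<le> a\<^sup>2 * ((u - \<kappa>) * (1 - u) - v\<^sup>2)"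
      using le unfolding SC(1) by linarith
    from mult_right_mono[OF this, of S]
    have "(1 - \<kappa>) * (a * ((1 - \<beta>) * (2 * S * C)) * C) \<le> a\<^sup>2 * (((u - \<kappa>) * (1 - u) - v\<^sup>2) * S)"
      using pos by (simp add: mult_ac power2_eq_square)
    then have "a\<^sup>2 * ((1 - \<kappa>) * v * C) \<le> a\<^sup>2 * (((u - \<kappa>) * (1 - u) - v\<^sup>2) * S)"
      unfolding av[symmetric] by (simp add: mult_ac power2_eq_square)
    then have "(1 - \<kappa>) * v * C \<le> ((u - \<kappa>) * (1 - u) - v\<^sup>2) * S"
      using pos by (simp add: mult_le_cancel_left_pos)
    moreover have "u = \<kappa> + (1 - \<kappa>) * \<alpha>" "v = (1 - \<kappa>) * \<delta>"
      using pos by (simp_all add: \<alpha>_def \<delta>_def)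
    moreover have "(\<kappa> + (1 - \<kappa>) * \<alpha> - \<kappa>) * (1 - (\<kappa> + (1 - \<kappa>) * \<alpha>)) - ((1 - \<kappa>) * \<delta>)\<^sup>2
        = (1 - \<kappa>)\<^sup>2 * (\<alpha> - \<alpha>\<^sup>2 - \<delta>\<^sup>2)" by algebra
    ultimately have "(1 - \<kappa>)\<^sup>2 * (\<delta> * C) \<le> (1 - \<kappa>)\<^sup>2 * ((\<alpha> - \<alpha>\<^sup>2 - \<delta>\<^sup>2) * S)"
      by (simp add: mult_ac power2_eq_square)
    then show ?thesis using pos by (simp add: mult_le_cancel_left_pos)
  qed
  define p where "p t = \<alpha> *\<^sub>R circle_pt K t - \<delta> *\<^sub>R quarter_turn (circle_pt K t)" for t
  define P where "P = convex hull (p ` {..<K})"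
  have P: "convex P" "closed P" "P \<noteq> {}"
  proof -
    have "compact P"
      unfolding P_def by (intro compact_convex_hull finite_imp_compact finite_imageI finite_lessThan)
    then show "closed P" by (rule compact_imp_closed)
    have "p 0 \<in> P" unfolding P_def using K by (intro hull_inc imageI) simp
    then show "P \<noteq> {}" by blast
  qed (simp add: P_def)
  have proj: "closest_point P (circle_pt K t) = p t" for t
  proof -
    have "closest_point P (circle_pt K (t mod K)) = p (t mod K)"
      unfolding P_def
      using circle_pt_dot[OF _ \<open>0 \<le> \<delta>\<close> _ _ key[unfolded S_def C_def]] K
      by (intro closest_point_convex_hull) (auto simp: p_def)
    then show ?thesis by (simp add: circle_pt_mod p_def)
  qed
  obtain f :: "real^2 \<Rightarrow> real" where f: "f \<in> F_class \<mu> L"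
    "grad f = (\<lambda>x. \<mu> *\<^sub>R x + (L - \<mu>) *\<^sub>R closest_point P x)"
    using squared_dist_to_convex[OF P, of \<mu> L] \<mu> by auto
  have "\<gamma> *\<^sub>R grad f (circle_pt K t) = ((1 + \<beta>) * (1 - c)) *\<^sub>R circle_pt K t
      - ((1 - \<beta>) * sin (2 * pi / real K)) *\<^sub>R quarter_turn (circle_pt K t)" for t
  proof -
    have L\<mu>: "L - \<mu> = L * (1 - \<kappa>)" "\<mu> = L * \<kappa>" using pos by (simp_all add: \<kappa>_def field_simps)
    have "\<gamma> * (\<mu> + (L - \<mu>) * \<alpha>) = a * (\<kappa> + (1 - \<kappa>) * \<alpha>)"
      "\<gamma> * ((L - \<mu>) * \<delta>) = a * ((1 - \<kappa>) * \<delta>)"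
      unfolding L\<mu>(1) unfolding L\<mu>(2) a_def by (simp_all add: algebra_simps)
    moreover have "\<kappa> + (1 - \<kappa>) * \<alpha> = u" "(1 - \<kappa>) * \<delta> = v"
      using pos by (simp_all add: \<alpha>_def \<delta>_def)
    moreover have "\<gamma> *\<^sub>R grad f (circle_pt K t) = (\<gamma> * (\<mu> + (L - \<mu>) * \<alpha>)) *\<^sub>R circle_pt K t
       - (\<gamma> * ((L - \<mu>) * \<delta>)) *\<^sub>R quarter_turn (circle_pt K t)"
      unfolding f(2) proj p_def by (simp add: algebra_simps)
    ultimately show ?thesis using pos by (simp add: u_def v_def)
  qed
  then have "HB \<gamma> \<beta> f (circle_pt K 0) (circle_pt K 1) t = circle_pt K t" for t
    by (induction t rule: induct_nat_012)
       (simp_all add: circle_pt_recurrence[of K _ \<beta>] c_def algebra_simps)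
  moreover have "circle_pt K 0 \<noteq> circle_pt K 1"
  proof -
    have "c < 1" using SC pos by simp
    then show ?thesis by (auto simp: circle_pt_def vec_eq_iff forall_2 c_def)
  qed
  ultimately have "cycles_on \<gamma> \<beta> f K (circle_pt K)"
    unfolding cycles_on_def circle_pt_mod using K by (intro conjI exI[of _ 0] exI[of _ 1]) auto
  with f(1) show ?thesis by blast
qed

section \<open>Choice of the polygon\<close>

text \<open>Halving an angle divides \<open>1 - cos\<close> by at most four, so the angles \<open>2 * pi / (3 * 2 ^ j)\<close>
  cannot skip an interval whose endpoints have ratio four.\<close>

lemma circle_angle_exists:
  fixes a :: real
  assumes "0 < a" "a \<le> 4"
  shows "\<exists>K\<ge>3. a / 10 \<le> 1 - cos (2 * pi / real K) \<and> 1 - cos (2 * pi / real K) \<le> 2 / 5 * a"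
proof -
  define s where "s j = 1 - cos (2 * pi / real (3 * 2 ^ j))" for j
  have half: "s j \<le> 4 * s (Suc j)" for j
  proof -
    define y where "y = 2 * pi / real (3 * 2 ^ Suc j)"
    have "2 * pi / real (3 * 2 ^ j) = 2 * y" by (simp add: y_def)
    then have "s j = 2 * (1 - (1 - s (Suc j))\<^sup>2)"
      unfolding s_def y_def[symmetric] by (simp add: cos_double_cos)
    then have "s j = 4 * s (Suc j) - 2 * (s (Suc j))\<^sup>2"
      by (simp add: algebra_simps power2_eq_square)
    then show ?thesis by simp
  qed
  have "s \<longlonglongrightarrow> 0"
  proof -
    have "(\<lambda>j. 2 * pi / real (3 * 2 ^ j)) \<longlonglongrightarrow> 0"
      using tendsto_mult_right_zero[OF LIMSEQ_inverse_realpow_zero[of 2], of "2 * pi / 3"]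
      by (simp add: field_simps)
    from tendsto_diff[OF tendsto_const[of 1] tendsto_cos[OF this]] show ?thesis
      unfolding s_def by simp
  qed
  then have ex: "\<exists>j. s j \<le> 2 / 5 * a"
    using assms(1) order_tendstoD(2)[of s 0 sequentially "2 / 5 * a"]
    by (auto simp: eventually_sequentially intro: less_imp_le)
  obtain j where j: "s j \<le> 2 / 5 * a" and least: "\<And>i. i < j \<Longrightarrow> 2 / 5 * a < s i"
    using exists_least_iff[THEN iffD1, OF ex] by (auto simp: not_le)
  have "a / 10 \<le> s j"
  proof (cases j)
    case 0
    \<comment> \<open>The triangle has no predecessor in the sequence; here \<open>a \<le> 4\<close>
      gives the lower bound directly.\<close>
    have "s 0 = 3 / 2" using cos_120 by (simp add: s_def mult.commute)
    then show ?thesis using 0 assms(2) by simp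
  next
    case (Suc i)
    then show ?thesis using least[of i] half[of i] by simp
  qed
  moreover have "3 \<le> 3 * (2::nat) ^ j" by simp
  ultimately show ?thesis using j unfolding s_def by blast
qed

text \<open>For \<open>s\<close> between \<open>a / 10\<close> and \<open>2 / 5 * a\<close>, the
  main part \<open>4 * s\<^sup>2 - 2 * a * s\<close> is at most \<open>- 4 / 25 * a\<^sup>2\<close>.
  Of this margin, \<open>3 / 25\<close> absorbs \<open>2 * a * e\<close> and \<open>1 / 25\<close>
  absorbs \<open>\<kappa> * a\<^sup>2\<close>.\<close>

lemma circle_condition:
  fixes a \<beta> \<kappa> s :: real
  assumes a: "0 < a" and e: "\<beta> < 1" "0 < \<beta>" "50/3 * (1 - \<beta>) \<le> a"
    and \<kappa>: "0 \<le> \<kappa>" "\<kappa> \<le> 1/25" and s: "a / 10 \<le> s" "s \<le> 2 / 5 * a"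
  defines "c \<equiv> 1 - s"
  shows "\<kappa> * a\<^sup>2 - 2 * (\<beta> - c + \<kappa> * (1 - \<beta> * c)) * a
           + 2 * (1 - c) * (1 + \<beta>\<^sup>2 - 2 * \<beta> * c) \<le> 0"
proof -
  define e where "e = 1 - \<beta>"
  have "0 \<le> (s - a / 10) * (2 / 5 * a - s)" using s by simp
  then have "4 * s\<^sup>2 + 4 / 25 * a\<^sup>2 \<le> 2 * a * s" by (simp add: field_simps power2_eq_square)
  \<comment> \<open>Here the constant \<open>50/3\<close> enters:
    \<open>e \<le> 3 / 50 * a\<close>.\<close>
  moreover have "2 * a * e \<le> 3 / 25 * a\<^sup>2"
    using mult_left_mono[OF e(3), of "3 / 25 * a"] a by (simp add: e_def power2_eq_square mult_ac)
  moreover have "\<kappa> * a\<^sup>2 \<le> 1 / 25 * a\<^sup>2" using \<kappa>(2) by (intro mult_right_mono) auto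
  \<comment> \<open>The last factor is nonnegative because
    \<open>2 * s \<ge> a / 5 \<ge> 10 / 3 * e\<close>.\<close>
  moreover have "0 \<le> 2 * s * e * (2 * s - e)"
    using a s e by (intro mult_nonneg_nonneg) (auto simp: e_def)
  moreover have "0 \<le> 2 * \<kappa> * a * (e + \<beta> * s)" using a s e \<kappa> by (auto simp: e_def)
  moreover have "\<kappa> * a\<^sup>2 - 2 * (\<beta> - c + \<kappa> * (1 - \<beta> * c)) * a + 2 * (1 - c) * (1 + \<beta>\<^sup>2 - 2 * \<beta> * c)
    = \<kappa> * a\<^sup>2 - 2 * a * s + 2 * a * e - 2 * \<kappa> * a * (e + \<beta> * s) + 4 * s\<^sup>2 - 2 * s * e * (2 * s - e)"
    unfolding c_def e_def by algebra
  ultimately show ?thesis by linarith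
qed

section \<open>Disjointness from the sublevel set\<close>

lemma compl_SLS_empty:
  fixes C \<mu> L :: real
  assumes C: "C > 50/3" and \<mu>: "0 < \<mu>" "\<mu> < L"
  shows "Omega_circ_compl TYPE('n::finite) \<mu> L
           \<inter> SLS TYPE('n) \<mu> L ((1 - C * (\<mu> / L)) / (1 + C * (\<mu> / L))) = {}"
proof (intro equals0I, elim IntE)
  fix z
  assume compl: "z \<in> Omega_circ_compl TYPE('n) \<mu> L"
    and sls: "z \<in> SLS TYPE('n) \<mu> L ((1 - C * (\<mu> / L)) / (1 + C * (\<mu> / L)))"
  obtain \<gamma> \<beta> where z: "z = (\<gamma>, \<beta>)" by (cases z)
  have "has_rate \<gamma> \<beta> (Q_class \<mu> L :: (real^'n \<Rightarrow> real) set)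
          ((1 - C * (\<mu> / L)) / (1 + C * (\<mu> / L)))"
    using sls unfolding z SLS_def by (simp add: rate_le_iff)
  note b = SLS_bounds[OF less_imp_le[OF C] \<mu> this]
  have "0 < 50/3 * (1 - \<beta>)" using b(2) by simp
  then have a: "0 < \<gamma> * L" using b(3) by (rule less_le_trans)
  then have "0 < \<gamma>" using \<mu> by (simp add: zero_less_mult_iff)
  obtain K where K: "3 \<le> K" "\<gamma> * L / 10 \<le> 1 - cos (2 * pi / real K)"
    "1 - cos (2 * pi / real K) \<le> 2 / 5 * (\<gamma> * L)"
    using circle_angle_exists[OF a b(4)] by blast
  have "0 \<le> \<mu> / L" using \<mu> by simp
  from circle_condition[OF a b(2,1,3) this b(5) K(2,3)]
  obtain f :: "real^2 \<Rightarrow> real" where "f \<in> F_class \<mu> L" "cycles_on \<gamma> \<beta> f K (circle_pt K)"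
    using cycles_on_circle[OF \<mu> K(1) \<open>0 < \<gamma>\<close> b(2)] by auto
  \<comment> \<open>Membership in \<open>Omega_cv\<close>, which \<open>Omega_K_circ\<close> also
    demands, is supplied by \<open>compl\<close>.\<close>
  then have "z \<in> Omega_circ TYPE('n) \<mu> L"
    using compl K(1) unfolding z Omega_circ_compl_def Omega_circ_def Omega_K_circ_def
    by (auto intro!: bexI[of _ K])
  then show False using compl unfolding Omega_circ_compl_def by blast
qed

theorem theorem3p6:
  shows "(\<exists>C>0. \<forall>\<mu> L :: real. 0 < \<mu> \<and> \<mu> < L \<longrightarrow>
            (let \<kappa> = \<mu> / L in
             Omega_circ_compl TYPE('n::finite) \<mu> L
               \<inter> SLS TYPE('n) \<mu> L ((1 - C * \<kappa>) / (1 + C * \<kappa>)) = {})) \<and>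
         (\<forall>C>50/3. \<forall>\<mu> L :: real. 0 < \<mu> \<and> \<mu> < L \<longrightarrow>
            (let \<kappa> = \<mu> / L in
             Omega_circ_compl TYPE('n) \<mu> L
               \<inter> SLS TYPE('n) \<mu> L ((1 - C * \<kappa>) / (1 + C * \<kappa>)) = {}))"
  \<comment> \<open>The witness \<open>17\<close> is the least integer above
    \<open>50/3\<close>.\<close>
  unfolding Let_def by (intro conjI exI[of _ 17] allI impI compl_SLS_empty) auto

end
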